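(* Let $n\geq 3$. Then $D(P_{n,1})=\lfloor n/2\rfloor+1$.
   Context: For positive integers $n,k$ with $2\le 2k<n$, the generalised Petersen graph $P_{n,k}$ has vertex set $\{u_i,v_i: i\in\{0,\dots,n-1\}\}$ and edge set $\{u_iu_{i+1}, v_iv_{i+k}, u_iv_i : i\in\{0,\dots,n-1\}\}$, indices modulo $n$ (so $P_{n,1}$ is the $n$-gonal prism). A signed graph $(G,E_-)$ is a simple graph $G$ with a set $E_-\subseteq E(G)$ of negative edges; other edges are positive. A cycle is positive if the product of its edge signs is positive; a signed graph is balanced if every cycle is positive. The frustration index $l(G,E_-)$ is the minimum number of edges whose deletion leaves a balanced signed graph, and the maximum frustration is $D(G)=\max_{E_-\subseteq E(G)} l(G,E_-)$. *)

theory Defs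
  imports Main
begin

record 'a ugraph =
  verts :: "'a set"
  edges :: "'a set set"

definition simple_graph :: "'a ugraph \<Rightarrow> bool" where
  "simple_graph G \<longleftrightarrow> finite (verts G) \<and> (\<forall>e \<in> edges G. e \<subseteq> verts G \<and> card e = 2)"

definition delete_edges :: "'a ugraph \<Rightarrow> 'a set set \<Rightarrow> 'a ugraph" where
  "delete_edges G F = G\<lparr>edges := edges G - F\<rparr>"

text \<open>A cycle is given by the list of its vertices in cyclic order; the edge number \<open>i\<close>
  joins entry \<open>i\<close> to its cyclic successor.\<close>

definition cycle_edge :: "'a list \<Rightarrow> nat \<Rightarrow> 'a set" where
  "cycle_edge xs i = {xs ! i, xs ! (Suc i mod length xs)}"

definition is_cycle :: "'a ugraph \<Rightarrow> 'a list \<Rightarrow> bool" where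
  "is_cycle G xs \<longleftrightarrow> 3 \<le> length xs \<and> distinct xs \<and> set xs \<subseteq> verts G \<and>
     (\<forall>i < length xs. cycle_edge xs i \<in> edges G)"

text \<open>A signed graph is a simple graph \<open>G\<close> together with a set \<open>N \<subseteq> edges G\<close> of negative edges.\<close>

definition edge_sign :: "'a set set \<Rightarrow> 'a set \<Rightarrow> int" where
  "edge_sign N e = (if e \<in> N then - 1 else 1)"

definition positive_cycle :: "'a set set \<Rightarrow> 'a list \<Rightarrow> bool" where
  "positive_cycle N xs \<longleftrightarrow> (\<Prod>i < length xs. edge_sign N (cycle_edge xs i)) > 0"

definition balanced :: "'a ugraph \<Rightarrow> 'a set set \<Rightarrow> bool" where
  "balanced G N \<longleftrightarrow> (\<forall>xs. is_cycle G xs \<longrightarrow> positive_cycle N xs)"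

text \<open>\<open>Min\<close> and \<open>Max\<close> below range over finite nonempty sets whenever \<open>G\<close> is a (finite) simple
  graph; see \<open>frustration_index_set\<close> and \<open>max_frustration_set\<close>.\<close>

definition frustration_index :: "'a ugraph \<Rightarrow> 'a set set \<Rightarrow> nat" where
  "frustration_index G N = Min {card F | F. F \<subseteq> edges G \<and> balanced (delete_edges G F) (N - F)}"

definition max_frustration :: "'a ugraph \<Rightarrow> nat" where
  "max_frustration G = Max {frustration_index G N | N. N \<subseteq> edges G}"

datatype gp_vertex = U nat | V nat

text \<open>The generalised Petersen graph, intended for \<open>2 \<le> 2 * k\<close> and \<open>2 * k < n\<close>.\<close>

definition gen_petersen :: "nat \<Rightarrow> nat \<Rightarrow> gp_vertex ugraph" where
  "gen_petersen n k = \<lparr>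
     verts = {U i | i. i < n} \<union> {V i | i. i < n},
     edges = {{U i, U ((i + 1) mod n)} | i. i < n}
           \<union> {{V i, V ((i + k) mod n)} | i. i < n}
           \<union> {{U i, V i} | i. i < n} \<rparr>"

lemma finite_edges_simple_graph:
  assumes "simple_graph G"
  shows "finite (edges G)"
proof (rule finite_subset)
  show "edges G \<subseteq> Pow (verts G)" using assms by (auto simp: simple_graph_def)
  show "finite (Pow (verts G))" using assms by (simp add: simple_graph_def)
qed

lemma frustration_index_set:
  assumes "simple_graph G"
  shows "finite {card F | F. F \<subseteq> edges G \<and> balanced (delete_edges G F) (N - F)}"
    and "{card F | F. F \<subseteq> edges G \<and> balanced (delete_edges G F) (N - F)} \<noteq> {}"
proof -
  have fin: "finite (Pow (edges G))"
    using finite_edges_simple_graph[OF assms] by simp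
  have "{card F | F. F \<subseteq> edges G \<and> balanced (delete_edges G F) (N - F)} \<subseteq> card ` Pow (edges G)"
    by auto
  then show "finite {card F | F. F \<subseteq> edges G \<and> balanced (delete_edges G F) (N - F)}"
    by (rule finite_subset) (use fin in simp)
  have "\<not> is_cycle (delete_edges G (edges G)) xs" for xs
    by (auto simp: is_cycle_def delete_edges_def intro!: exI[of _ 0])
  then have "balanced (delete_edges G (edges G)) (N - edges G)"
    by (simp add: balanced_def)
  then show "{card F | F. F \<subseteq> edges G \<and> balanced (delete_edges G F) (N - F)} \<noteq> {}"
    by blast
qed

lemma max_frustration_set:
  assumes "simple_graph G"
  shows "finite {frustration_index G N | N. N \<subseteq> edges G}"
    and "{frustration_index G N | N. N \<subseteq> edges G} \<noteq> {}"
proof -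
  have "{frustration_index G N | N. N \<subseteq> edges G} = frustration_index G ` Pow (edges G)"
    by auto
  then show "finite {frustration_index G N | N. N \<subseteq> edges G}"
    using finite_edges_simple_graph[OF assms] by simp
  show "{frustration_index G N | N. N \<subseteq> edges G} \<noteq> {}"
    by blast
qed

lemma add_mod_neq:
  fixes i k n :: nat
  assumes "0 < k" "k < n" "i < n"
  shows "(i + k) mod n \<noteq> i"
proof (cases "i + k < n")
  case True
  then show ?thesis using assms by simp
next
  case False
  then have "(i + k) mod n = i + k - n"
    using assms by (simp add: mod_if)
  then show ?thesis using assms False by linarith
qed

lemma simple_graph_gen_petersen:
  assumes "2 \<le> 2 * k" "2 * k < n"
  shows "simple_graph (gen_petersen n k)"
proof -
  have "i \<noteq> (i + 1) mod n" "i \<noteq> (i + k) mod n" if "i < n" for i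
    using add_mod_neq[of 1 n i] add_mod_neq[of k n i] that assms by auto
  then show ?thesis
    using assms by (auto simp: simple_graph_def gen_petersen_def card_insert_if)
qed

end

theory Submission
  imports Defs
begin

text \<open>
  Lower bound: make exactly one outer edge negative, together with the inner edges of all other
  quadrilaterals. Then all \<open>n\<close> quadrilaterals and the outer \<open>n\<close>-cycle are negative, so the
  deleted edges must meet all of these \<open>n + 1\<close> cycles, while every edge lies on at most two of them.

  Upper bound: for a two-colouring of the vertices, deleting the edges whose sign disagrees with
  the colouring leaves a balanced graph. Choose the set \<open>r\<close> of bad spokes so that the
  quadrilaterals whose bad spokes do not account for their sign (\<open>unsettled\<close>) are as few as possible;
  \<open>r\<close> can be replaced by its complement, so it has at most \<open>n / 2\<close> elements. Such a quadrilateral needs one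
  further bad edge, which may be taken on either the outer or the inner cycle, and this freedom
  fixes the parity of the outer cycle. If the signs of all quadrilaterals are accounted for and
  \<open>r\<close> is nonempty, dropping one spoke from \<open>r\<close> creates two such quadrilaterals at a net cost
  of one.
\<close>

section \<open>Frustration and vertex colourings\<close>

lemma prod_cyclic_shift:
  fixes f :: "nat \<Rightarrow> 'a :: comm_monoid_mult"
  shows "(\<Prod>i<n. f (Suc i mod n)) = (\<Prod>i<n. f i)"
proof (cases n)
  case (Suc m)
  have "(\<Prod>i<m. f (Suc i mod Suc m)) = (\<Prod>i<m. f (Suc i))"
    by (rule prod.cong) auto
  then show ?thesis
    unfolding Suc by (subst prod.lessThan_Suc_shift, subst prod.lessThan_Suc) (simp add: mult.commute)
qed simp

text \<open>Outside \<open>F\<close> the sign of an edge is the product of the signs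
  \<open>s\<close> of its ends. Around a surviving cycle every vertex is counted twice, so the
  product of the edge signs is a nonzero square.\<close>

lemma frustration_index_le_colouring:
  assumes "simple_graph G" "F \<subseteq> edges G"
    and col: "\<And>u v. {u, v} \<in> edges G \<Longrightarrow> {u, v} \<notin> F \<Longrightarrow> {u, v} \<in> N \<longleftrightarrow> \<sigma> u \<noteq> (\<sigma> v :: bool)"
  shows "frustration_index G N \<le> card F"
proof -
  define s where "s v = (if \<sigma> v then 1 else - 1 :: int)" for v
  have "positive_cycle (N - F) xs" if "is_cycle (delete_edges G F) xs" for xs
  proof -
    let ?n = "length xs"
    have "edge_sign (N - F) (cycle_edge xs i) = s (xs ! i) * s (xs ! (Suc i mod ?n))" if "i < ?n" for i
    proof -
      have "cycle_edge xs i \<in> edges G" "cycle_edge xs i \<notin> F"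
        using \<open>is_cycle _ _\<close> that by (auto simp: is_cycle_def delete_edges_def)
      then show ?thesis
        using col[of "xs ! i" "xs ! (Suc i mod ?n)"]
        by (auto simp: cycle_edge_def edge_sign_def s_def)
    qed
    then have "(\<Prod>i<?n. edge_sign (N - F) (cycle_edge xs i))
        = (\<Prod>i<?n. s (xs ! i)) * (\<Prod>i<?n. s (xs ! (Suc i mod ?n)))"
      by (simp add: prod.distrib)
    also have "\<dots> = (\<Prod>i<?n. s (xs ! i)) ^ 2"
      using prod_cyclic_shift[of "\<lambda>i. s (xs ! i)"] by (simp add: power2_eq_square)
    also have "\<dots> > 0"
      by (auto simp: s_def)
    finally show ?thesis
      by (simp add: positive_cycle_def)
  qed
  then have "balanced (delete_edges G F) (N - F)"
    by (simp add: balanced_def)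
  then show ?thesis
    unfolding frustration_index_def
    using assms(1,2) by (intro Min_le frustration_index_set) auto
qed

lemma frustration_index_attained:
  assumes "simple_graph G"
  obtains F where "F \<subseteq> edges G" "balanced (delete_edges G F) (N - F)"
    "card F = frustration_index G N"
  using Min_in[OF frustration_index_set[OF assms], of N]
  by (auto simp: frustration_index_def)

text \<open>A negative cycle avoiding \<open>F\<close> would survive the deletion with its signs
  unchanged.\<close>

lemma negative_cycle_meets_deleted:
  assumes "balanced (delete_edges G F) (N - F)" "is_cycle G xs" "\<not> positive_cycle N xs"
  shows "\<exists>i<length xs. cycle_edge xs i \<in> F"
proof (rule ccontr)
  assume none: "\<not> ?thesis"
  then have "is_cycle (delete_edges G F) xs"
    using assms(2) by (auto simp: is_cycle_def delete_edges_def)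
  then have "positive_cycle (N - F) xs"
    using assms(1) by (simp add: balanced_def)
  moreover have "positive_cycle (N - F) xs \<longleftrightarrow> positive_cycle N xs"
    unfolding positive_cycle_def using none
    by (intro arg_cong[where f = "\<lambda>x. x > 0"] prod.cong) (auto simp: edge_sign_def)
  ultimately show False
    using assms(3) by simp
qed

section \<open>Edges of the prism\<close>

definition outer :: "nat \<Rightarrow> nat \<Rightarrow> gp_vertex set" where
  "outer n i = {U i, U (Suc i mod n)}"

definition inner :: "nat \<Rightarrow> nat \<Rightarrow> gp_vertex set" where
  "inner n i = {V i, V (Suc i mod n)}"

definition spoke :: "nat \<Rightarrow> gp_vertex set" where
  "spoke i = {U i, V i}"

lemma edges_prism:
  "edges (gen_petersen n (Suc 0)) = outer n ` {..<n} \<union> inner n ` {..<n} \<union> spoke ` {..<n}"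
  by (auto simp: gen_petersen_def outer_def inner_def spoke_def)

lemma prism_edges_intros:
  assumes "i < n"
  shows "outer n i \<in> edges (gen_petersen n 1)" "inner n i \<in> edges (gen_petersen n 1)"
    "spoke i \<in> edges (gen_petersen n 1)"
  using assms by (simp_all add: edges_prism)

lemma prism_edge_cases:
  assumes "e \<in> edges (gen_petersen n 1)"
  obtains i where "i < n" "e = outer n i" | i where "i < n" "e = inner n i"
  | i where "i < n" "e = spoke i"
  using assms by (auto simp: edges_prism)

lemma Suc_mod_inj:
  assumes "i < n" "j < n" "Suc i mod n = Suc j mod n"
  shows "i = j"
  using assms by (auto simp: mod_Suc split: if_splits)

text \<open>Controls the cyclic predecessor of \<open>j\<close>, the index of the second
  quadrilateral through \<open>spoke j\<close>, without a formula for it.\<close>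

lemma card_Suc_mod_vimage_le: "card {i. i < n \<and> j = Suc i mod n} \<le> 1"
  by (rule card_le_Suc0_iff_eq[THEN iffD2, folded One_nat_def]) (auto intro: Suc_mod_inj)

lemma Suc_mod_neq: "2 \<le> n \<Longrightarrow> i < n \<Longrightarrow> Suc i mod n \<noteq> i"
  by (auto simp: mod_Suc)

lemma Suc_Suc_mod_neq: "3 \<le> n \<Longrightarrow> i < n \<Longrightarrow> Suc (Suc i mod n) mod n \<noteq> i"
  by (auto simp: mod_Suc)

text \<open>Matching the ends crosswise would make \<open>i\<close> its own second successor, which
  is impossible on a cycle of length at least three.\<close>

lemma outer_eq_iff:
  assumes "3 \<le> n" "i < n" "j < n"
  shows "outer n i = outer n j \<longleftrightarrow> i = j"
  using assms Suc_Suc_mod_neq[of n i] by (auto simp: outer_def doubleton_eq_iff)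

lemma inner_eq_iff:
  assumes "3 \<le> n" "i < n" "j < n"
  shows "inner n i = inner n j \<longleftrightarrow> i = j"
  using assms Suc_Suc_mod_neq[of n i] by (auto simp: inner_def doubleton_eq_iff)

lemma spoke_eq_iff: "spoke i = spoke j \<longleftrightarrow> i = j"
  by (auto simp: spoke_def doubleton_eq_iff)

lemma prism_edges_distinct:
  "outer n i \<noteq> inner n j" "outer n i \<noteq> spoke j" "inner n i \<noteq> spoke j"
  "inner n j \<noteq> outer n i" "spoke j \<noteq> outer n i" "spoke j \<noteq> inner n i"
  by (auto simp: outer_def inner_def spoke_def doubleton_eq_iff)

section \<open>Lower bound\<close>

definition quad :: "nat \<Rightarrow> nat \<Rightarrow> gp_vertex list" where
  "quad n i = [U i, U (Suc i mod n), V (Suc i mod n), V i]"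

lemma cycle_edge_quad:
  "cycle_edge (quad n i) 0 = outer n i"
  "cycle_edge (quad n i) (Suc 0) = spoke (Suc i mod n)"
  "cycle_edge (quad n i) 2 = inner n i"
  "cycle_edge (quad n i) 3 = spoke i"
  by (simp_all add: cycle_edge_def quad_def outer_def inner_def spoke_def insert_commute)

lemma less_4_cases: "(i::nat) < 4 \<Longrightarrow> i = 0 \<or> i = Suc 0 \<or> i = 2 \<or> i = 3"
  by arith

lemma is_cycle_quad:
  assumes "3 \<le> n" "i < n"
  shows "is_cycle (gen_petersen n 1) (quad n i)"
proof -
  have "cycle_edge (quad n i) j \<in> edges (gen_petersen n 1)" if "j < 4" for j
    using less_4_cases[OF that] prism_edges_intros[of i n] prism_edges_intros[of "Suc i mod n" n]
      assms by (elim disjE) (simp_all add: cycle_edge_quad)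
  moreover have "length (quad n i) = 4"
    by (simp add: quad_def)
  moreover have "distinct (quad n i)" "set (quad n i) \<subseteq> verts (gen_petersen n 1)"
    using assms Suc_mod_neq[of n i] by (simp_all add: quad_def gen_petersen_def)
  ultimately show ?thesis
    by (simp add: is_cycle_def)
qed

definition rim :: "nat \<Rightarrow> gp_vertex list" where
  "rim n = map U [0..<n]"

lemma cycle_edge_rim: "i < n \<Longrightarrow> cycle_edge (rim n) i = outer n i"
  by (auto simp: cycle_edge_def rim_def outer_def)

lemma is_cycle_rim: "3 \<le> n \<Longrightarrow> is_cycle (gen_petersen n 1) (rim n)"
  unfolding is_cycle_def
  by (intro conjI allI impI)
    (auto simp: rim_def distinct_map inj_on_def gen_petersen_def cycle_edge_rim[unfolded rim_def]
      outer_def)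

lemma frustration_index_prism_ge:
  assumes n: "3 \<le> n"
  defines "N \<equiv> {outer n 0} \<union> inner n ` {1..<n}"
  shows "n div 2 + 1 \<le> frustration_index (gen_petersen n 1) N"
proof -
  let ?G = "gen_petersen n 1"
  have G: "simple_graph ?G"
    using n by (intro simple_graph_gen_petersen) auto
  obtain F where F: "F \<subseteq> edges ?G" "balanced (delete_edges ?G F) (N - F)"
    "card F = frustration_index ?G N"
    using frustration_index_attained[OF G] by blast
  have outer_N: "outer n i \<in> N \<longleftrightarrow> i = 0" if "i < n" for i
    using that n by (auto simp: N_def prism_edges_distinct outer_eq_iff)
  have inner_N: "inner n i \<in> N \<longleftrightarrow> i \<noteq> 0" if "i < n" for i
  proof -
    have "i = j" if "inner n i = inner n j" "j < n" for j
      using that \<open>i < n\<close> n by (simp add: inner_eq_iff)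
    then show ?thesis
      using that by (fastforce simp: N_def prism_edges_distinct)
  qed
  have spoke_N: "spoke i \<notin> N" for i
    by (auto simp: N_def prism_edges_distinct)
  \<comment> \<open>Exactly one edge of each quadrilateral is negative: the outer one for
    \<open>i = 0\<close>, the inner one otherwise.\<close>
  have quad_F: "outer n i \<in> F \<or> inner n i \<in> F \<or> spoke i \<in> F \<or> spoke (Suc i mod n) \<in> F"
    if i: "i < n" for i
  proof -
    have len: "length (quad n i) = 4"
      by (simp add: quad_def)
    have "{..<4} = {0, Suc 0, 2, 3}"
      by auto
    then have "(\<Prod>j<4. edge_sign N (cycle_edge (quad n i) j)) = - 1"
      using outer_N[OF i] inner_N[OF i] spoke_N
      by (simp add: cycle_edge_quad edge_sign_def)
    then have "\<not> positive_cycle N (quad n i)"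
      by (simp add: positive_cycle_def len)
    from negative_cycle_meets_deleted[OF F(2) is_cycle_quad[OF n i] this]
    obtain j where "j < 4" "cycle_edge (quad n i) j \<in> F"
      by (auto simp: len)
    then show ?thesis
      using less_4_cases[of j] by (auto simp: cycle_edge_quad)
  qed
  have rim_F: "\<exists>i<n. outer n i \<in> F"
  proof -
    have len: "length (rim n) = n"
      by (simp add: rim_def)
    have "(\<Prod>j<n. edge_sign N (cycle_edge (rim n) j)) = (\<Prod>j<n. if j = 0 then - 1 else 1)"
      using outer_N by (intro prod.cong) (simp_all add: cycle_edge_rim edge_sign_def)
    also have "\<dots> = - 1"
      using n by (simp add: prod.delta)
    finally have "\<not> positive_cycle N (rim n)"
      by (simp add: positive_cycle_def len)
    from negative_cycle_meets_deleted[OF F(2) is_cycle_rim[OF n] this] show ?thesis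
      by (auto simp: len cycle_edge_rim)
  qed
  \<comment> \<open>Number \<open>i < n\<close> stands for a quadrilateral, number \<open>n\<close> for the outer cycle.\<close>
  define faces where "faces e = {i. i < n \<and>
      (e = outer n i \<or> e = inner n i \<or> e = spoke i \<or> e = spoke (Suc i mod n))}
    \<union> {i. i = n \<and> e \<in> outer n ` {..<n}}" for e
  have faces_le: "card (faces e) \<le> 2" if "e \<in> edges ?G" for e
    using that
  proof (cases rule: prism_edge_cases)
    case (1 i)
    then have "faces e \<subseteq> {i, n}"
      using n by (auto simp: faces_def outer_eq_iff prism_edges_distinct)
    then show ?thesis
      using card_mono[of "{i, n}" "faces e"] 1 by simp
  next
    case (2 i)
    then have "faces e \<subseteq> {i, n}"
      using n by (auto simp: faces_def inner_eq_iff prism_edges_distinct)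
    then show ?thesis
      using card_mono[of "{i, n}" "faces e"] 2 by simp
  next
    case (3 i)
    \<comment> \<open>A spoke lies on quadrilateral \<open>i\<close> and on the preceding one,
      collected in \<open>P\<close>, but never on the outer cycle.\<close>
    define P where "P = {j. j < n \<and> i = Suc j mod n}"
    have "card P \<le> 1"
      unfolding P_def by (rule card_Suc_mod_vimage_le)
    moreover have "faces e \<subseteq> insert i P" "finite P"
      using 3 by (auto simp: faces_def P_def spoke_eq_iff prism_edges_distinct)
    ultimately show ?thesis
      using card_mono[of "insert i P" "faces e"] card_insert_le_m1[of 2 P i] by simp
  qed
  have "finite F"
    using F(1) finite_edges_simple_graph[OF G] finite_subset by blast
  have "{..n} \<subseteq> (\<Union>e\<in>F. faces e)"
  proof
    fix i assume "i \<in> {..n}"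
    then consider "i < n" | "i = n" by fastforce
    then show "i \<in> (\<Union>e\<in>F. faces e)"
      using quad_F[of i] rim_F by cases (auto simp: faces_def)
  qed
  moreover have "finite (\<Union>e\<in>F. faces e)"
    using \<open>finite F\<close> by (auto simp: faces_def)
  ultimately have "card {..n} \<le> card (\<Union>e\<in>F. faces e)"
    by (intro card_mono)
  also have "\<dots> \<le> (\<Sum>e\<in>F. card (faces e))"
    using \<open>finite F\<close> by (rule card_UN_le)
  also have "\<dots> \<le> card F * 2"
    using F(1) faces_le sum_bounded_above[of F "\<lambda>e. card (faces e)" 2] by auto
  \<comment> \<open>The count gives \<open>n + 1 \<le> 2 * card F\<close>; rounding up yields the
    bound.\<close>
  finally show ?thesis
    using F(3) by simp
qed

section \<open>Upper bound\<close>

text \<open>Partial sums integrate \<open>g\<close> modulo 2 along the cycle. Only the closing step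
  back to the empty sum at index 0 can fail, and it fails exactly when the total is odd.\<close>

lemma parity_partial_sums_cyclic:
  fixes g :: "nat \<Rightarrow> nat"
  assumes "i < n"
  shows "odd (\<Sum>j<i. g j) \<noteq> odd (\<Sum>j<Suc i mod n. g j)
    \<longleftrightarrow> odd (g i) \<noteq> (Suc i = n \<and> odd (\<Sum>j<n. g j))"
proof (cases "Suc i = n")
  case True
  then show ?thesis by auto
next
  case False
  then show ?thesis using assms by auto
qed

definition quad_neg :: "nat \<Rightarrow> gp_vertex set set \<Rightarrow> nat \<Rightarrow> bool" where
  "quad_neg n N i \<longleftrightarrow> odd (of_bool (outer n i \<in> N) + of_bool (inner n i \<in> N)
      + of_bool (spoke i \<in> N) + of_bool (spoke (Suc i mod n) \<in> N) :: nat)"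

text \<open>With \<open>r\<close> as the set of bad spokes, this says that an odd number of the
  outer and inner edges at \<open>i\<close> must be bad, hence exactly one of them.\<close>

definition unsettled :: "nat \<Rightarrow> gp_vertex set set \<Rightarrow> (nat \<Rightarrow> bool) \<Rightarrow> nat \<Rightarrow> bool" where
  "unsettled n N r i \<longleftrightarrow> quad_neg n N i \<noteq> (r i \<noteq> r (Suc i mod n))"

text \<open>Bad edges go on the inner cycle by default, and \<open>m\<close> is the place where the
  parity of the outer cycle is repaired if necessary. At an unsettled \<open>m\<close> the bad edge
  just moves from inner to outer, at no cost; otherwise both edges at \<open>m\<close> become bad,
  which costs 2.\<close>

lemma frustration_index_prism_le:
  assumes n: "3 \<le> n" and m: "m < n"
  shows "frustration_index (gen_petersen n 1) N
    \<le> card {i. i < n \<and> r i} + card {i. i < n \<and> unsettled n N r i}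
      + (if unsettled n N r m then 0 else 2)"
proof -
  let ?G = "gen_petersen n 1"
  have G: "simple_graph ?G"
    using n by (intro simple_graph_gen_petersen) auto
  define S where "S = (\<Sum>i<n. of_bool (outer n i \<in> N) :: nat)"
  \<comment> \<open>\<open>p\<close> and \<open>q\<close> mark the bad outer and inner edges.
    Reversing the sign at the edges in \<open>p\<close> makes the total of \<open>g\<close> even, so
    that the colouring \<open>x\<close> of the outer cycle closes up.\<close>
  define p where "p i \<longleftrightarrow> i = m \<and> odd S" for i
  define q where "q i \<longleftrightarrow> unsettled n N r i \<noteq> p i" for i
  define g where "g i = (of_bool (outer n i \<in> N) + of_bool (p i) :: nat)" for i
  define x where "x i \<longleftrightarrow> odd (\<Sum>j<i. g j)" for i
  \<comment> \<open>The inner colours are forced by requiring that spoke \<open>i\<close> be bad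
    exactly when \<open>r i\<close>.\<close>
  define y where "y i \<longleftrightarrow> x i \<noteq> ((spoke i \<in> N) \<noteq> r i)" for i
  define \<sigma> where "\<sigma> v = (case v of U i \<Rightarrow> x i | V i \<Rightarrow> y i)" for v
  have "(\<Sum>i<n. of_bool (p i) :: nat) = (\<Sum>i<n. if i = m then of_bool (odd S) else 0)"
    by (rule sum.cong) (auto simp: p_def)
  also have "\<dots> = of_bool (odd S)"
    using m by (simp add: sum.delta)
  finally have even: "even (\<Sum>i<n. g i)"
    by (simp add: g_def sum.distrib S_def[symmetric])
  have x: "x i \<noteq> x (Suc i mod n) \<longleftrightarrow> (outer n i \<in> N) \<noteq> p i" if "i < n" for i
    using parity_partial_sums_cyclic[OF that, of g] even by (auto simp: x_def g_def)
  have y: "y i \<noteq> y (Suc i mod n) \<longleftrightarrow> (inner n i \<in> N) \<noteq> q i" if "i < n" for i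
    using x[OF that] by (auto simp: y_def q_def unsettled_def quad_neg_def)
  define F where "F = outer n ` {i. i < n \<and> p i} \<union> inner n ` {i. i < n \<and> q i}
    \<union> spoke ` {i. i < n \<and> r i}"
  have "frustration_index ?G N \<le> card F"
  proof (rule frustration_index_le_colouring[OF G])
    show "F \<subseteq> edges ?G"
      by (auto simp: F_def edges_prism)
  next
    fix u v assume e: "{u, v} \<in> edges ?G" and nF: "{u, v} \<notin> F"
    from e show "{u, v} \<in> N \<longleftrightarrow> \<sigma> u \<noteq> \<sigma> v"
    proof (cases rule: prism_edge_cases)
      case (1 i)
      then have "\<not> p i" using nF by (auto simp: F_def)
      with x[OF 1(1)] have "outer n i \<in> N \<longleftrightarrow> x i \<noteq> x (Suc i mod n)" by simp
      moreover have "u = U i \<and> v = U (Suc i mod n) \<or> u = U (Suc i mod n) \<and> v = U i"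
        using 1(2) by (simp add: outer_def doubleton_eq_iff)
      ultimately have "outer n i \<in> N \<longleftrightarrow> \<sigma> u \<noteq> \<sigma> v"
        by (elim disjE) (auto simp: \<sigma>_def)
      then show ?thesis using 1(2) by simp
    next
      case (2 i)
      then have "\<not> q i" using nF by (auto simp: F_def)
      with y[OF 2(1)] have "inner n i \<in> N \<longleftrightarrow> y i \<noteq> y (Suc i mod n)" by simp
      moreover have "u = V i \<and> v = V (Suc i mod n) \<or> u = V (Suc i mod n) \<and> v = V i"
        using 2(2) by (simp add: inner_def doubleton_eq_iff)
      ultimately have "inner n i \<in> N \<longleftrightarrow> \<sigma> u \<noteq> \<sigma> v"
        by (elim disjE) (auto simp: \<sigma>_def)
      then show ?thesis using 2(2) by simp
    next
      case (3 i)
      then have "\<not> r i" using nF by (auto simp: F_def)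
      then have "spoke i \<in> N \<longleftrightarrow> x i \<noteq> y i" by (auto simp: y_def)
      moreover have "u = U i \<and> v = V i \<or> u = V i \<and> v = U i"
        using 3(2) by (simp add: spoke_def doubleton_eq_iff)
      ultimately have "spoke i \<in> N \<longleftrightarrow> \<sigma> u \<noteq> \<sigma> v"
        by (elim disjE) (auto simp: \<sigma>_def)
      then show ?thesis using 3(2) by simp
    qed
  qed
  also have "card F \<le> card {i. i < n \<and> p i} + card {i. i < n \<and> q i} + card {i. i < n \<and> r i}"
    unfolding F_def
    by (intro order_trans[OF card_Un_le] add_mono card_image_le) auto
  also have "card {i. i < n \<and> p i} + card {i. i < n \<and> q i}
      \<le> card {i. i < n \<and> unsettled n N r i} + (if unsettled n N r m then 0 else 2)"
  proof (cases "odd S")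
    case False
    then show ?thesis by (simp add: p_def q_def)
  next
    case True
    let ?A = "{i. i < n \<and> unsettled n N r i}"
    have p: "{i. i < n \<and> p i} = {m}"
      using True m by (auto simp: p_def)
    show ?thesis
    proof (cases "unsettled n N r m")
      case True
      have "{i. i < n \<and> q i} = ?A - {m}"
        using True \<open>odd S\<close> m by (auto simp: q_def p_def)
      moreover have "card ?A = Suc (card (?A - {m}))"
        using True m by (intro card.remove) auto
      ultimately show ?thesis by (simp add: p)
    next
      case False
      have "{i. i < n \<and> q i} \<subseteq> insert m ?A"
        by (auto simp: q_def p_def)
      then have "card {i. i < n \<and> q i} \<le> card (insert m ?A)"
        by (intro card_mono) auto
      also have "\<dots> \<le> Suc (card ?A)"
        by (rule card_insert_le_m1) auto
      finally show ?thesis using False by (simp add: p)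
    qed
  qed
  finally show ?thesis by simp
qed

lemma frustration_index_prism_upper:
  assumes n: "3 \<le> n"
  shows "frustration_index (gen_petersen n 1) N \<le> n div 2 + 1"
proof -
  note bound = frustration_index_prism_le[OF n, of _ N]
  define g where "g i = (of_bool (quad_neg n N i) :: nat)" for i
  \<comment> \<open>\<open>r0\<close> changes across exactly the negative quadrilaterals, except
    possibly at the closing step. Complementing it preserves all changes, so the smaller of the two
    sets can be used.\<close>
  define r0 where "r0 i \<longleftrightarrow> odd (\<Sum>j<i. g j)" for i
  define flip where "flip \<longleftrightarrow> card {i. i < n \<and> r0 i} > n div 2"
  define r where "r i \<longleftrightarrow> r0 i \<noteq> flip" for i
  have r_le: "card {i. i < n \<and> r i} \<le> n div 2"
  proof (cases flip)
    case True
    have "card ({..<n} - {i. i < n \<and> r0 i}) = n - card {i. i < n \<and> r0 i}"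
      by (subst card_Diff_subset) auto
    moreover have "{..<n} - {i. i < n \<and> r0 i} = {i. i < n \<and> r i}"
      using True by (auto simp: r_def)
    ultimately show ?thesis using True by (simp add: flip_def)
  next
    case False
    then show ?thesis by (simp add: r_def flip_def)
  qed
  have settled: "unsettled n N r i \<longleftrightarrow> Suc i = n \<and> odd (\<Sum>j<n. g j)"
    if "i < n" for i
    using parity_partial_sums_cyclic[OF that, of g] by (auto simp: unsettled_def r_def r0_def g_def)
  show ?thesis
  proof (cases "odd (\<Sum>j<n. g j)")
    case True
    have "{i. i < n \<and> unsettled n N r i} = {n - 1}"
    proof (rule set_eqI)
      fix i
      show "i \<in> {i. i < n \<and> unsettled n N r i} \<longleftrightarrow> i \<in> {n - 1}"
        using settled[of i] True n by (cases "i < n") (simp, linarith, simp)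
    qed
    moreover have "unsettled n N r (n - 1)"
      using settled[of "n - 1"] True n by simp
    \<comment> \<open>The single unsettled quadrilateral \<open>n - 1\<close> serves as
      \<open>m\<close>, so the cost is at most \<open>n div 2 + 1 + 0\<close>.\<close>
    ultimately show ?thesis
      using bound[of "n - 1" r] r_le n by (simp del: One_nat_def)
  next
    case False
    then have quad_neg: "quad_neg n N i \<longleftrightarrow> r i \<noteq> r (Suc i mod n)" if "i < n" for i
      using settled[OF that] by (simp add: unsettled_def)
    show ?thesis
    proof (cases "\<exists>j<n. r j")
      \<comment> \<open>Only the parity of the outer cycle can require bad edges: the cost is at
        most 2, within the bound since \<open>n div 2 \<ge> 1\<close>.\<close>
      case no_spoke: False
      have "card {i. i < n \<and> unsettled n N r i} = 0"
        using settled False by simp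
      moreover have "card {i. i < n \<and> r i} = 0"
        using no_spoke by simp
      moreover have "frustration_index (gen_petersen n 1) N
          \<le> card {i. i < n \<and> r i} + card {i. i < n \<and> unsettled n N r i} + 2"
        using bound[of 0 r] n by (simp split: if_splits)
      moreover have "n div 2 \<ge> 1"
        using n by simp
      ultimately show ?thesis
        by linarith
    next
      case True
      then obtain j where j: "j < n" "r j" by blast
      define r' where "r' i \<longleftrightarrow> r i \<and> i \<noteq> j" for i
      define P where "P = {i. i < n \<and> j = Suc i mod n}"
      have "card P \<le> 1"
        unfolding P_def by (rule card_Suc_mod_vimage_le)
      \<comment> \<open>Dropping spoke \<open>j\<close> affects only the quadrilaterals containing
        it: number \<open>j\<close> and its predecessor.\<close>
      moreover have "{i. i < n \<and> unsettled n N r' i} \<subseteq> insert j P"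
        using quad_neg by (auto simp: unsettled_def r'_def P_def)
      moreover have "finite P"
        by (simp add: P_def)
      ultimately have two: "card {i. i < n \<and> unsettled n N r' i} \<le> 2"
        using card_mono[of "insert j P" "{i. i < n \<and> unsettled n N r' i}"]
          card_insert_le_m1[of 2 P j] by simp
      \<comment> \<open>The other spoke of quadrilateral \<open>j\<close> differs from
        \<open>j\<close> and keeps its status, so this quadrilateral does become unsettled and the
        parity repair at \<open>m = j\<close> is free.\<close>
      have "unsettled n N r' j"
        using quad_neg[OF j(1)] Suc_mod_neq[of n j] n j by (simp add: unsettled_def r'_def)
      then have "frustration_index (gen_petersen n 1) N \<le> card {i. i < n \<and> r' i} + 2"
        using bound[of j r'] two j by (simp split: if_splits)
      moreover have "{i. i < n \<and> r' i} = {i. i < n \<and> r i} - {j}"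
        by (auto simp: r'_def)
      moreover have "card {i. i < n \<and> r i} = Suc (card ({i. i < n \<and> r i} - {j}))"
        using j by (intro card.remove) auto
      ultimately show ?thesis
        using r_le by simp
    qed
  qed
qed

theorem theorem3p5:
  fixes n :: nat
  assumes "n \<ge> 3"
  shows "max_frustration (gen_petersen n 1) = n div 2 + 1"
proof -
  let ?G = "gen_petersen n 1"
  let ?N = "{outer n 0} \<union> inner n ` {1..<n}"
  have G: "simple_graph ?G"
    using assms by (intro simple_graph_gen_petersen) auto
  have "?N \<subseteq> edges ?G"
    using assms by (auto simp: edges_prism)
  moreover have "frustration_index ?G ?N = n div 2 + 1"
    using frustration_index_prism_ge[OF assms] frustration_index_prism_upper[OF assms]
    by (rule antisym[rotated])
  ultimately show ?thesis
    unfolding max_frustration_def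
    using frustration_index_prism_upper[OF assms]
    by (intro Max_eqI max_frustration_set[OF G]) (auto intro: sym)
qed

end
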